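(* Let $\mathbf{G}(s)=\mathbf{B}^T\mathbf{Q}\,(s\mathbf{I}-(\mathbf{J}-\mathbf{R})\mathbf{Q})^{-1}\mathbf{B}$ be a linear port-Hamiltonian system of state dimension $n$ with $m$ inputs and $m$ outputs, i.e. $\mathbf{J},\mathbf{R},\mathbf{Q}\in\mathbb{R}^{n\times n}$, $\mathbf{B}\in\mathbb{R}^{n\times m}$, $\mathbf{J}=-\mathbf{J}^T$, $\mathbf{R}=\mathbf{R}^T\ge 0$, $\mathbf{Q}=\mathbf{Q}^T>0$. Let $s_1,\dots,s_r\in\mathbb{C}$ be $r$ distinct interpolation points with corresponding tangent directions $\mathbf{b}_1,\dots,\mathbf{b}_r\in\mathbb{C}^m$, the collection being closed under conjugation (if $s_j=\overline{s_i}$ then $\mathbf{b}_j=\overline{\mathbf{b}_i}$, and every $\overline{s_i}$ occurs among the $s_j$). Assume that each $s_i\mathbf{I}-(\mathbf{J}-\mathbf{R})\mathbf{Q}$ is invertible, and that $$\mathbf{V}_r=\big[(s_1\mathbf{I}-(\mathbf{J}-\mathbf{R})\mathbf{Q})^{-1}\mathbf{B}\mathbf{b}_1,\ \ldots,\ (s_r\mathbf{I}-(\mathbf{J}-\mathbf{R})\mathbf{Q})^{-1}\mathbf{B}\mathbf{b}_r\big]\in\mathbb{C}^{n\times r}$$ has full column rank. Let $\mathbf{M}\in\mathbb{C}^{r\times r}$ be any nonsingular matrix such that $\widehat{\mathbf{V}}_r=\mathbf{V}_r\mathbf{M}$ is real. Define $\widehat{\mathbf{W}}_r=\mathbf{Q}\widehat{\mathbf{V}}_r(\widehat{\mathbf{V}}_r^T\mathbf{Q}\widehat{\mathbf{V}}_r)^{-1}$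 and $$\mathbf{J}_r=\widehat{\mathbf{W}}_r^T\mathbf{J}\widehat{\mathbf{W}}_r,\quad \mathbf{R}_r=\widehat{\mathbf{W}}_r^T\mathbf{R}\widehat{\mathbf{W}}_r,\quad \mathbf{Q}_r=\widehat{\mathbf{V}}_r^T\mathbf{Q}\widehat{\mathbf{V}}_r,\quad \mathbf{B}_r=\widehat{\mathbf{W}}_r^T\mathbf{B},$$ and assume that $s_i\mathbf{I}_r-(\mathbf{J}_r-\mathbf{R}_r)\mathbf{Q}_r$ is invertible for $i=1,\dots,r$. Then the reduced-order model $$\dot{\mathbf{x}}_r=(\mathbf{J}_r-\mathbf{R}_r)\mathbf{Q}_r\mathbf{x}_r+\mathbf{B}_r\mathbf{u},\qquad \mathbf{y}_r=\mathbf{B}_r^T\mathbf{Q}_r\mathbf{x}_r,$$ with transfer function $\mathbf{G}_r(s)=\mathbf{B}_r^T\mathbf{Q}_r(s\mathbf{I}_r-(\mathbf{J}_r-\mathbf{R}_r)\mathbf{Q}_r)^{-1}\mathbf{B}_r$, is port-Hamiltonian, is passive, and satisfies $$\mathbf{G}(s_i)\mathbf{b}_i=\mathbf{G}_r(s_i)\mathbf{b}_i\qquad\text{for } i=1,\dots,r.$$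
   Context: A (linear) port-Hamiltonian system of state dimension $k$ is a real system $\dot{\mathbf{x}}=(\mathbf{J}-\mathbf{R})\mathbf{Q}\mathbf{x}+\mathbf{B}\mathbf{u}$, $\mathbf{y}=\mathbf{B}^T\mathbf{Q}\mathbf{x}$ with $\mathbf{J},\mathbf{R},\mathbf{Q}\in\mathbb{R}^{k\times k}$, $\mathbf{B}\in\mathbb{R}^{k\times m}$, $\mathbf{J}=-\mathbf{J}^T$, $\mathbf{R}=\mathbf{R}^T$ positive semidefinite, and $\mathbf{Q}=\mathbf{Q}^T$ positive definite. Its transfer function is $\mathbf{B}^T\mathbf{Q}(s\mathbf{I}-(\mathbf{J}-\mathbf{R})\mathbf{Q})^{-1}\mathbf{B}$; a system and its transfer function are denoted by the same symbol. Passive means that along all trajectories the stored energy $H(\mathbf{x})=\frac12\mathbf{x}^T\mathbf{Q}\mathbf{x}\ge 0$ satisfies $\frac{d}{dt}H(\mathbf{x}(t))\le\mathbf{u}(t)^T\mathbf{y}(t)$. *)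

theory Defs
  imports "HOL-Analysis.Analysis"
begin

definition pos_semidef_matrix :: "real^'n^'n \<Rightarrow> bool"
  where "pos_semidef_matrix A \<longleftrightarrow> (\<forall>x. 0 \<le> x \<bullet> (A *v x))"

definition pos_def_matrix :: "real^'n^'n \<Rightarrow> bool"
  where "pos_def_matrix A \<longleftrightarrow> (\<forall>x. x \<noteq> 0 \<longrightarrow> 0 < x \<bullet> (A *v x))"

text \<open>
  A linear port-Hamiltonian system is given by its coefficients \<open>J\<close>, \<open>R\<close>, \<open>Q\<close>, \<open>B\<close>:
  the state equation is \<open>x' = (J - R) Q x + B u\<close> and the output is \<open>y = B\<^sup>T Q x\<close>.
  The type \<open>real^'m^'n\<close> consists of the matrices with rows indexed by \<open>'n\<close> and columns
  indexed by \<open>'m\<close>.  No condition is imposed on \<open>B\<close>.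
\<close>

definition port_hamiltonian ::
  "real^'n^'n \<Rightarrow> real^'n^'n \<Rightarrow> real^'n^'n \<Rightarrow> real^'m^'n \<Rightarrow> bool"
  where "port_hamiltonian J R Q B \<longleftrightarrow>
    J = - transpose J \<and>
    R = transpose R \<and> pos_semidef_matrix R \<and>
    Q = transpose Q \<and> pos_def_matrix Q"

definition ph_output :: "real^'n^'n \<Rightarrow> real^'m^'n \<Rightarrow> real^'n \<Rightarrow> real^'m"
  where "ph_output Q B x = (transpose B ** Q) *v x"

definition stored_energy :: "real^'n^'n \<Rightarrow> real^'n \<Rightarrow> real"
  where "stored_energy Q x = (1 / 2) * (x \<bullet> (Q *v x))"

text \<open>
  Trajectories are classical solutions on a time interval \<open>T\<close>, with one-sided derivatives
  at the endpoints that belong to \<open>T\<close>.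
\<close>

definition ph_trajectory ::
  "real^'n^'n \<Rightarrow> real^'n^'n \<Rightarrow> real^'n^'n \<Rightarrow> real^'m^'n \<Rightarrow>
   real set \<Rightarrow> (real \<Rightarrow> real^'m) \<Rightarrow> (real \<Rightarrow> real^'n) \<Rightarrow> bool"
  where "ph_trajectory J R Q B T u x \<longleftrightarrow>
    (\<forall>t\<in>T. (x has_vector_derivative (((J - R) ** Q) *v x t + B *v u t)) (at t within T))"

text \<open>
  The interior of \<open>T\<close> is required to be nonempty so that derivatives within \<open>T\<close> are unique.
\<close>

definition ph_passive ::
  "real^'n^'n \<Rightarrow> real^'n^'n \<Rightarrow> real^'n^'n \<Rightarrow> real^'m^'n \<Rightarrow> bool"
  where "ph_passive J R Q B \<longleftrightarrow>
    (\<forall>x. 0 \<le> stored_energy Q x) \<and>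
    (\<forall>T u x. is_interval T \<and> interior T \<noteq> {} \<and> ph_trajectory J R Q B T u x \<longrightarrow>
      (\<forall>t\<in>T. \<exists>D. ((\<lambda>\<tau>. stored_energy Q (x \<tau>)) has_real_derivative D) (at t within T) \<and>
        D \<le> u t \<bullet> ph_output Q B (x t)))"

definition complex_matrix :: "real^'n^'m \<Rightarrow> complex^'n^'m"
  where "complex_matrix = map_matrix complex_of_real"

definition cnj_vec :: "complex^'n \<Rightarrow> complex^'n"
  where "cnj_vec v = (\<chi> i. cnj (v $ i))"

text \<open>The matrix \<open>s I - (J - R) Q\<close>; \<open>mat s\<close> is the scalar matrix with diagonal entries \<open>s\<close>.\<close>

definition ph_pencil ::
  "real^'n^'n \<Rightarrow> real^'n^'n \<Rightarrow> real^'n^'n \<Rightarrow> complex \<Rightarrow> complex^'n^'n"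
  where "ph_pencil J R Q s = mat s - complex_matrix ((J - R) ** Q)"

definition transfer_function ::
  "real^'n^'n \<Rightarrow> real^'n^'n \<Rightarrow> real^'n^'n \<Rightarrow> real^'m^'n \<Rightarrow> complex \<Rightarrow> complex^'m^'m"
  where "transfer_function J R Q B s =
    complex_matrix (transpose B ** Q) ** matrix_inv (ph_pencil J R Q s) ** complex_matrix B"

text \<open>The matrix whose column with index \<open>i\<close> is \<open>(s\<^sub>i I - (J - R) Q)\<^sup>-\<^sup>1 B b\<^sub>i\<close>.\<close>

definition interpolation_basis ::
  "real^'n^'n \<Rightarrow> real^'n^'n \<Rightarrow> real^'n^'n \<Rightarrow> real^'m^'n \<Rightarrow>
   ('r \<Rightarrow> complex) \<Rightarrow> ('r \<Rightarrow> complex^'m) \<Rightarrow> complex^'r^'n"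
  where "interpolation_basis J R Q B s b =
    (\<chi> k i. (matrix_inv (ph_pencil J R Q (s i)) *v (complex_matrix B *v b i)) $ k)"

end

theory Submission
  imports Defs
begin

text \<open>
  The projection satisfies \<open>Wh\<^sup>T Vh = I\<close> and, because \<open>Q\<close> is symmetric, \<open>Wh Qr = Q Vh\<close>.  Hence the
  reduced coefficients are a Petrov-Galerkin projection,
  \<open>(Jr - Rr) Qr = Wh\<^sup>T (J - R) Q Vh\<close> and \<open>Br\<^sup>T Qr = B\<^sup>T Q Vh\<close>, while their
  symmetry properties are those of congruent matrices.  If the state \<open>(s I - (J - R) Q)\<^sup>-\<^sup>1 B b\<close> equals
  \<open>Vh z\<close>, then multiplying \<open>(s I - (J - R) Q) Vh z = B b\<close> by \<open>Wh\<^sup>T\<close> shows that \<open>z\<close> is the reduced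
  state for the same input, so that both systems produce the output \<open>B\<^sup>T Q Vh z\<close>.
\<close>

section \<open>Inverses and matrix arithmetic\<close>

lemma matrix_inv_left:
  assumes "invertible A"
  shows "matrix_inv A ** A = mat 1"
  using someI_ex[OF assms[unfolded invertible_def]] by (simp add: matrix_inv_def)

lemma matrix_inv_right:
  assumes "invertible A"
  shows "A ** matrix_inv A = mat 1"
  using someI_ex[OF assms[unfolded invertible_def]] by (simp add: matrix_inv_def)

lemma matrix_vector_mult_solve:
  assumes "invertible A" and "A *v x = y"
  shows "matrix_inv A *v y = x"
  using assms by (metis matrix_inv_left matrix_vector_mul_assoc matrix_vector_mul_lid)

lemma matrix_diff_ldistrib: "A ** (B - C) = A ** B - A ** C"
  for A :: "'a::ring_1^'n^'m"
  by (vector matrix_matrix_mult_def sum_subtractf[symmetric] right_diff_distrib)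

lemma matrix_diff_rdistrib: "(A - B) ** C = A ** C - B ** C"
  for A :: "'a::ring_1^'n^'m"
  by (vector matrix_matrix_mult_def sum_subtractf[symmetric] left_diff_distrib)

lemma matrix_mul_uminus_right: "A ** (- B) = - (A ** B)"
  for A :: "'a::ring_1^'n^'m"
  by (vector matrix_matrix_mult_def sum_negf)

lemma matrix_mul_uminus_left: "(- A) ** B = - (A ** B)"
  for A :: "'a::ring_1^'n^'m"
  by (vector matrix_matrix_mult_def sum_negf)

lemma inner_matrix_vector_mult: "x \<bullet> (A *v y) = (transpose A *v x) \<bullet> y"
  for A :: "real^'n^'m"
  by (metis dot_lmul_matrix vector_transpose_matrix transpose_transpose)

lemma mat_vector_mult: "mat c *v x = c *s x"
  for x :: "'a::semiring_1^'n"
  by (simp add: mat_def matrix_vector_mult_def vec_eq_iff if_distrib if_distribR cong: if_cong)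

lemma matrix_vector_mult_axis: "A *v axis i 1 = column i A"
  for A :: "'a::semiring_1^'n^'m"
  by (simp add: column_def axis_def matrix_vector_mult_def vec_eq_iff if_distrib cong: if_cong)

text \<open>The rank is the dimension of the row space, so a rank equal to the number of columns
  makes the rows span the whole space, which is equivalent to left invertibility.\<close>

lemma full_rank_left_inverse:
  fixes A :: "'a::field^'n^'m"
  assumes "rank A = CARD('n)"
  obtains L where "L ** A = mat 1"
proof -
  have "vec.span (rows A) = UNIV"
    using assms vec.dim_eq_full[of "rows A"]
    by (simp add: row_rank_def_gen card_cart_basis vec.dimension_def)
  then show ?thesis
    using that matrix_left_invertible_span_rows_gen by blast
qed

section \<open>Real matrices viewed over the complex numbers\<close>

lemma complex_matrix_mult: "complex_matrix (A ** B) = complex_matrix A ** complex_matrix B"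
  by (simp add: complex_matrix_def vec_eq_iff matrix_matrix_mult_def)

lemma complex_matrix_mat_1: "complex_matrix (mat 1) = mat 1"
  by (simp add: complex_matrix_def vec_eq_iff mat_def)

text \<open>Taking real parts commutes with multiplication by a real matrix. This carries full
  column rank over the complex numbers down to a real left inverse.\<close>

lemma complex_matrix_left_inverse:
  fixes A :: "real^'n^'m"
  assumes "N ** complex_matrix A = mat 1"
  shows "map_matrix Re N ** A = mat 1"
proof -
  have "map_matrix Re N ** A = map_matrix Re (N ** complex_matrix A)"
    by (simp add: complex_matrix_def vec_eq_iff matrix_matrix_mult_def Re_sum)
  also have "\<dots> = mat 1"
    unfolding assms by (simp add: vec_eq_iff mat_def)
  finally show ?thesis .
qed

lemma ph_pencil_vector_mult:
  "ph_pencil J R Q s *v x = s *s x - complex_matrix ((J - R) ** Q) *v x"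
  by (simp add: ph_pencil_def matrix_vector_mult_diff_rdistrib mat_vector_mult)

section \<open>Congruence and definiteness\<close>

lemma skew_symmetric_congruence:
  fixes A :: "real^'n^'n" and W :: "real^'r^'n"
  assumes "A = - transpose A"
  shows "transpose W ** A ** W = - transpose (transpose W ** A ** W)"
proof -
  have "transpose A = - A"
    using assms by (metis minus_minus)
  then show ?thesis
    by (simp add: matrix_transpose_mul matrix_mul_assoc[symmetric]
        matrix_mul_uminus_left matrix_mul_uminus_right)
qed

lemma symmetric_congruence:
  fixes A :: "real^'n^'n" and W :: "real^'r^'n"
  assumes "A = transpose A"
  shows "transpose W ** A ** W = transpose (transpose W ** A ** W)"
  using assms by (simp add: matrix_transpose_mul matrix_mul_assoc)

lemma inner_congruence: "x \<bullet> ((transpose W ** A ** W) *v x) = (W *v x) \<bullet> (A *v (W *v x))"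
  for A :: "real^'n^'n" and W :: "real^'r^'n"
  using inner_matrix_vector_mult[of x "transpose W" "A *v (W *v x)"]
  by (simp only: matrix_vector_mul_assoc[symmetric] transpose_transpose)

lemma pos_semidef_congruence:
  assumes "pos_semidef_matrix A"
  shows "pos_semidef_matrix (transpose W ** A ** W)"
  using assms by (simp add: pos_semidef_matrix_def inner_congruence)

text \<open>The left inverse makes \<open>W\<close> injective, so a nonzero \<open>x\<close> is
  tested by \<open>A\<close> at the nonzero vector \<open>W *v x\<close>.\<close>

lemma pos_def_congruence:
  assumes "pos_def_matrix A" and "L ** W = mat 1"
  shows "pos_def_matrix (transpose W ** A ** W)"
proof -
  have "W *v x \<noteq> 0" if "x \<noteq> 0" for x
    using assms(2) that
    by (metis matrix_vector_mul_assoc matrix_vector_mul_lid matrix_vector_mult_0_right)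
  then show ?thesis
    using assms(1) by (simp add: pos_def_matrix_def inner_congruence)
qed

text \<open>A nonzero kernel vector would make the quadratic form vanish.\<close>

lemma pos_def_matrix_invertible:
  assumes "pos_def_matrix A"
  shows "invertible A"
proof -
  have "\<forall>x. A *v x = 0 \<longrightarrow> x = 0"
    using assms by (metis inner_zero_right less_irrefl pos_def_matrix_def)
  then show ?thesis
    by (simp add: invertible_left_inverse matrix_left_invertible_ker)
qed

section \<open>Energy balance and passivity\<close>

lemma skew_symmetric_quadratic_form:
  fixes A :: "real^'n^'n"
  assumes "A = - transpose A"
  shows "x \<bullet> (A *v x) = 0"
proof -
  have "transpose A *v x = - (A *v x)"
    using assms by (metis (no_types) add.inverse_inverse diff_0 matrix_vector_mult_0
        matrix_vector_mult_diff_rdistrib)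
  \<comment> \<open>Moving \<open>A\<close> across the inner product transposes it, so the form
    equals its own negative.\<close>
  then have "x \<bullet> (A *v x) = - (x \<bullet> (A *v x))"
    by (metis inner_commute inner_matrix_vector_mult inner_minus_left)
  then show ?thesis by simp
qed

text \<open>The product rule gives two terms; symmetry of \<open>Q\<close> makes them equal, and the
  factor 1/2 in the energy absorbs the doubling.\<close>

lemma stored_energy_derivative:
  fixes Q :: "real^'n^'n"
  assumes "Q = transpose Q" and "(x has_vector_derivative x') (at t within T)"
  shows "((\<lambda>\<tau>. stored_energy Q (x \<tau>)) has_real_derivative (Q *v x t) \<bullet> x') (at t within T)"
proof -
  have Qx: "((\<lambda>\<tau>. Q *v x \<tau>) has_vector_derivative Q *v x') (at t within T)"
    using bounded_linear.has_vector_derivative[OF matrix_vector_mul_bounded_linear assms(2)] .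
  have "((\<lambda>\<tau>. x \<tau> \<bullet> (Q *v x \<tau>)) has_vector_derivative x t \<bullet> (Q *v x') + x' \<bullet> (Q *v x t))
      (at t within T)"
    using bounded_bilinear.has_vector_derivative[OF bounded_bilinear_inner assms(2) Qx] .
  moreover have "x t \<bullet> (Q *v x') + x' \<bullet> (Q *v x t) = 2 * ((Q *v x t) \<bullet> x')"
    using assms(1) by (metis inner_commute inner_matrix_vector_mult mult_2)
  ultimately have "((\<lambda>\<tau>. x \<tau> \<bullet> (Q *v x \<tau>)) has_real_derivative 2 * ((Q *v x t) \<bullet> x')) (at t within T)"
    by (simp add: has_real_derivative_iff_has_vector_derivative)
  from DERIV_cmult[OF this, of "1 / 2"] show ?thesis
    by (simp add: stored_energy_def)
qed

text \<open>The left-hand side is the rate of change of the energy along the state equation. The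
  skew part \<open>J\<close> does no work, the input term is the supplied power, and
  \<open>R\<close> accounts for the dissipation.\<close>

lemma port_hamiltonian_power_balance:
  assumes "port_hamiltonian J R Q B"
  shows "(Q *v x) \<bullet> (((J - R) ** Q) *v x + B *v u)
    = u \<bullet> ph_output Q B x - (Q *v x) \<bullet> (R *v (Q *v x))"
proof -
  have "(Q *v x) \<bullet> (J *v (Q *v x)) = 0"
    using assms unfolding port_hamiltonian_def by (intro skew_symmetric_quadratic_form) auto
  moreover have "(Q *v x) \<bullet> (B *v u) = u \<bullet> ph_output Q B x"
    by (simp add: ph_output_def matrix_vector_mul_assoc[symmetric] inner_matrix_vector_mult
        inner_commute)
  ultimately show ?thesis
    by (simp add: matrix_vector_mul_assoc[symmetric] matrix_vector_mult_diff_rdistrib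
        inner_add_right inner_diff_right)
qed

text \<open>By the power balance, the energy rate differs from the supplied power by the dissipation
  term, which semidefiniteness of \<open>R\<close> makes nonnegative.\<close>

lemma port_hamiltonian_passive:
  assumes "port_hamiltonian J R Q B"
  shows "ph_passive J R Q B"
  unfolding ph_passive_def
proof (intro conjI allI impI ballI)
  show "0 \<le> stored_energy Q x" for x
    using assms unfolding port_hamiltonian_def pos_def_matrix_def stored_energy_def
    by (cases "x = 0") (auto simp: less_imp_le)
next
  fix T u x t
  assume "is_interval T \<and> interior T \<noteq> {} \<and> ph_trajectory J R Q B T u x" and "t \<in> T"
  then have "(x has_vector_derivative (((J - R) ** Q) *v x t + B *v u t)) (at t within T)"
    by (simp add: ph_trajectory_def)
  with assms have "((\<lambda>\<tau>. stored_energy Q (x \<tau>)) has_real_derivative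
      (Q *v x t) \<bullet> (((J - R) ** Q) *v x t + B *v u t)) (at t within T)"
    by (intro stored_energy_derivative) (auto simp: port_hamiltonian_def)
  moreover have "0 \<le> (Q *v x t) \<bullet> (R *v (Q *v x t))"
    using assms by (simp add: port_hamiltonian_def pos_semidef_matrix_def)
  ultimately show "\<exists>D. ((\<lambda>\<tau>. stored_energy Q (x \<tau>)) has_real_derivative D) (at t within T)
      \<and> D \<le> u t \<bullet> ph_output Q B (x t)"
    by (auto simp: port_hamiltonian_power_balance[OF assms])
qed

section \<open>Structure-preserving projection and interpolation\<close>

lemma port_hamiltonian_congruence:
  assumes "port_hamiltonian J R Q B" and "L ** V = mat 1"
  shows "port_hamiltonian (transpose W ** J ** W) (transpose W ** R ** W)
    (transpose V ** Q ** V) C"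
  using assms unfolding port_hamiltonian_def
  by (blast intro: skew_symmetric_congruence symmetric_congruence pos_semidef_congruence
      pos_def_congruence)

lemma transfer_function_projection:
  fixes J R Q :: "real^'n^'n" and B :: "real^'m^'n" and V W :: "real^'r^'n"
    and Jr Rr Qr :: "real^'r^'r"
  assumes WV: "transpose W ** V = mat 1"
    and WQr: "W ** Qr = Q ** V"
    and Jr: "Jr = transpose W ** J ** W"
    and Rr: "Rr = transpose W ** R ** W"
    and Br: "Br = transpose W ** B"
    and inv: "invertible (ph_pencil J R Q s)"
    and inv_r: "invertible (ph_pencil Jr Rr Qr s)"
    and z: "matrix_inv (ph_pencil J R Q s) *v (complex_matrix B *v b) = complex_matrix V *v z"
  shows "transfer_function J R Q B s *v b = transfer_function Jr Rr Qr Br s *v b"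
proof -
  let ?A = "(J - R) ** Q"
  let ?Wt = "complex_matrix (transpose W)"
  \<comment> \<open>The product \<open>W ** Qr\<close> is kept together so that \<open>WQr\<close>
    can replace it by \<open>Q ** V\<close>.\<close>
  have "(Jr - Rr) ** Qr = transpose W ** (J - R) ** (W ** Qr)"
    unfolding Jr Rr by (simp add: matrix_diff_ldistrib matrix_diff_rdistrib matrix_mul_assoc)
  then have A: "(Jr - Rr) ** Qr = transpose W ** ?A ** V"
    by (simp add: WQr matrix_mul_assoc)
  have "?Wt *v (complex_matrix V *v z) = z"
    by (simp add: matrix_vector_mul_assoc complex_matrix_mult[symmetric] WV complex_matrix_mat_1)
  \<comment> \<open>The shift term \<open>s *s z\<close> matches because \<open>W\<close> is
    biorthogonal to \<open>V\<close>; the remaining term is the fact \<open>A\<close>.\<close>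
  then have "ph_pencil Jr Rr Qr s *v z
      = ?Wt *v (ph_pencil J R Q s *v (complex_matrix V *v z))"
    by (simp add: ph_pencil_vector_mult A complex_matrix_mult matrix_vector_mul_assoc[symmetric]
        matrix_vector_mult_diff_distrib vector_scalar_commute)
  also have "\<dots> = ?Wt *v (complex_matrix B *v b)"
    by (metis z inv matrix_inv_right matrix_vector_mul_assoc matrix_vector_mul_lid)
  also have "\<dots> = complex_matrix Br *v b"
    by (simp add: Br complex_matrix_mult matrix_vector_mul_assoc)
  finally have zr: "matrix_inv (ph_pencil Jr Rr Qr s) *v (complex_matrix Br *v b) = z"
    by (rule matrix_vector_mult_solve[OF inv_r])
  have "transpose Br ** Qr = transpose B ** Q ** V"
    by (simp add: Br matrix_transpose_mul matrix_mul_assoc[symmetric] WQr)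
  then show ?thesis
    by (simp add: transfer_function_def matrix_vector_mul_assoc[symmetric] z zr complex_matrix_mult)
qed

theorem theorem7:
  fixes J R Q :: "real^'n^'n" and B :: "real^'m^'n"
    and s :: "'r::finite \<Rightarrow> complex" and b :: "'r \<Rightarrow> complex^'m"
    and V :: "complex^'r^'n" and M :: "complex^'r^'r"
    and Vh Wh :: "real^'r^'n"
    and Jr Rr Qr :: "real^'r^'r" and Br :: "real^'m^'r"
  assumes "port_hamiltonian J R Q B"
    and "inj s"
    and "\<And>i. \<exists>j. s j = cnj (s i)"
    and "\<And>i j. s j = cnj (s i) \<Longrightarrow> b j = cnj_vec (b i)"
    and "\<And>i. invertible (ph_pencil J R Q (s i))"
    and "V = interpolation_basis J R Q B s b"
    and "rank V = CARD('r)"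
    and "invertible M"
    and "complex_matrix Vh = V ** M"
    and "Wh = Q ** Vh ** matrix_inv (transpose Vh ** Q ** Vh)"
    and "Jr = transpose Wh ** J ** Wh"
    and "Rr = transpose Wh ** R ** Wh"
    and "Qr = transpose Vh ** Q ** Vh"
    and "Br = transpose Wh ** B"
    and "\<And>i. invertible (ph_pencil Jr Rr Qr (s i))"
  shows "port_hamiltonian Jr Rr Qr Br
    \<and> ph_passive Jr Rr Qr Br
    \<and> (\<forall>i. transfer_function J R Q B (s i) *v b i = transfer_function Jr Rr Qr Br (s i) *v b i)"
proof -
  note ph = assms(1) and V = assms(6) and Vh = assms(9)
  note Wh = assms(10) and Jr = assms(11) and Rr = assms(12) and Qr = assms(13)
  obtain L where L: "L ** V = mat 1"
    using full_rank_left_inverse[OF assms(7)] .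
  \<comment> \<open>The complex left inverse of \<open>V ** M\<close> is assembled from those of the
    two factors; its real part serves as \<open>N\<close>.\<close>
  have "(matrix_inv M ** L) ** complex_matrix Vh = matrix_inv M ** (L ** V) ** M"
    by (simp add: Vh matrix_mul_assoc)
  also have "\<dots> = mat 1"
    by (simp add: L matrix_inv_left assms(8))
  finally obtain N where N: "N ** Vh = mat 1"
    using complex_matrix_left_inverse by blast
  \<comment> \<open>The left inverse \<open>N\<close> gives definiteness of \<open>Qr\<close> first:
    its invertibility is what allows the inverse inside \<open>Wh\<close> to be cancelled
    afterwards.\<close>
  have ph_r: "port_hamiltonian Jr Rr Qr Br"
    unfolding Jr Rr Qr by (rule port_hamiltonian_congruence[OF ph N])
  then have Qr_sym: "transpose Qr = Qr" and inv: "invertible Qr"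
    by (auto simp: port_hamiltonian_def intro: pos_def_matrix_invertible)
  have Wh_Qr: "Wh ** Qr = Q ** Vh"
    using matrix_inv_left[OF inv] by (metis Wh Qr matrix_mul_assoc matrix_mul_rid)
  have "transpose Q = Q"
    using ph by (simp add: port_hamiltonian_def)
  \<comment> \<open>Transposing \<open>Wh_Qr\<close> and multiplying by \<open>Vh\<close> on the
    right turns \<open>transpose Vh ** Q ** Vh\<close> back into \<open>Qr\<close>, which is then
    cancelled.\<close>
  then have "Qr = Qr ** (transpose Wh ** Vh)"
    using arg_cong[OF Wh_Qr, of transpose]
    by (simp add: matrix_transpose_mul Qr_sym matrix_mul_assoc Qr)
  then have Wh_Vh: "transpose Wh ** Vh = mat 1"
    by (metis inv matrix_inv_left matrix_mul_assoc matrix_mul_lid)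
  have "transfer_function J R Q B (s i) *v b i = transfer_function Jr Rr Qr Br (s i) *v b i" for i
  proof -
    have "matrix_inv (ph_pencil J R Q (s i)) *v (complex_matrix B *v b i) = V *v axis i 1"
      by (simp add: V interpolation_basis_def matrix_vector_mult_axis column_def)
    \<comment> \<open>Inserting \<open>M ** matrix_inv M\<close> expresses column \<open>i\<close>
      of \<open>V\<close> in the real basis; the coordinates \<open>matrix_inv M *v axis i 1\<close>
      may be complex and serve as \<open>z\<close>.\<close>
    also have "\<dots> = complex_matrix Vh *v (matrix_inv M *v axis i 1)"
      by (metis Vh assms(8) matrix_inv_right matrix_mul_assoc matrix_mul_rid matrix_vector_mul_assoc)
    finally show ?thesis
      by (rule transfer_function_projection[OF Wh_Vh Wh_Qr Jr Rr assms(14) assms(5) assms(15)])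
  qed
  with ph_r show ?thesis
    using port_hamiltonian_passive by blast
qed

end
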